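(* Let $\Omega\subset\mathbb R^n$ be a smooth bounded domain, let $V$ be a potential on $\Omega$, and let $a\in\Omega$ be such that there exist $\eta>0$, $c>0$ and a real number $m<2$ with $$V(x)\le\frac c{|x-a|^m}\qquad\text{for all }x\in\Omega\cap B(a;2\eta),\ x\ne a.$$ Then $\mathrm{Cap}_{V,\infty}(\{a\})>0$.
   Context: $B(a;r)$ is the open ball of center $a$ and radius $r$. A potential on $\Omega$ is a measurable function $V:\Omega\to[0,+\infty]$ that is not identically zero (a.e.). For $\psi\in C^2_c(\Omega)$, $$\|\psi\|_{V,\infty}=\|\psi\|_{L^1(\Omega)}+\Big\|\frac{\nabla\psi}{\sqrt V}\Big\|_{L^\infty(\Omega)}+\Big\|\frac{\Delta\psi}{V}\Big\|_{L^\infty(\Omega)}\in[0,+\infty],$$ where a quotient is taken to be $0$ where its numerator vanishes or where $V=+\infty$, and to be $+\infty$ in absolute value where $V=0$ and the numerator is nonzero. For a compact $K\subset\Omega$, $$\mathbb B^2_K=\{\psi\in C^2_c(\Omega):\ 0\le\psi\le1,\ \psi=1\text{ in a neighborhood of }K\},\qquad \mathrm{Cap}_{V,\infty}(K)=\inf\{\|\psi\|_{V,\infty}:\ \psi\in\mathbb B^2_K\}.$$ *)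

theory Defs
  imports "HOL-Analysis.Analysis" "HOL-Probability.Essential_Supremum"
begin

section \<open>Differentiability classes, gradient and Laplacian\<close>

definition partial :: "'a::euclidean_space \<Rightarrow> ('a \<Rightarrow> real) \<Rightarrow> 'a \<Rightarrow> real" where
  "partial i f x = frechet_derivative f (at x) i"

text \<open>The class \<open>C\<^sup>k(S)\<close>; meaningful for open \<open>S\<close>, since derivatives are taken
  in the full space at the points of \<open>S\<close>.\<close>

primrec Ck_on :: "nat \<Rightarrow> ('a::euclidean_space \<Rightarrow> real) \<Rightarrow> 'a set \<Rightarrow> bool" where
  "Ck_on 0 f S \<longleftrightarrow> continuous_on S f"
| "Ck_on (Suc k) f S \<longleftrightarrow>
     (\<forall>x\<in>S. f differentiable (at x)) \<and> (\<forall>i\<in>Basis. Ck_on k (partial i f) S)"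

definition Cinf_on :: "('a::euclidean_space \<Rightarrow> real) \<Rightarrow> 'a set \<Rightarrow> bool" where
  "Cinf_on f S \<longleftrightarrow> (\<forall>k. Ck_on k f S)"

definition gradient :: "('a::euclidean_space \<Rightarrow> real) \<Rightarrow> 'a \<Rightarrow> 'a" where
  "gradient f x = (\<Sum>i\<in>Basis. partial i f x *\<^sub>R i)"

definition laplacian :: "('a::euclidean_space \<Rightarrow> real) \<Rightarrow> 'a \<Rightarrow> real" where
  "laplacian f x = (\<Sum>i\<in>Basis. partial i (partial i f) x)"

section \<open>Smooth bounded domains\<close>

text \<open>Near each boundary point the domain is, up to a rotation of the axes, the region strictly
  above the graph of a smooth function of the remaining \<open>n - 1\<close> coordinates. The unit
  vector \<open>e\<close> is the vertical direction, and \<open>\<gamma>\<close> is only evaluated at projections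
  onto the hyperplane orthogonal to \<open>e\<close>.\<close>

definition smooth_boundary :: "'a::euclidean_space set \<Rightarrow> bool" where
  "smooth_boundary \<Omega> \<longleftrightarrow>
     (\<forall>p\<in>frontier \<Omega>. \<exists>r>0. \<exists>e \<gamma>. norm e = 1 \<and> Cinf_on \<gamma> UNIV \<and>
        \<Omega> \<inter> ball p r = {x \<in> ball p r. x \<bullet> e > \<gamma> (x - (x \<bullet> e) *\<^sub>R e)})"

definition smooth_bounded_domain :: "'a::euclidean_space set \<Rightarrow> bool" where
  "smooth_bounded_domain \<Omega> \<longleftrightarrow>
     open \<Omega> \<and> connected \<Omega> \<and> \<Omega> \<noteq> {} \<and> bounded \<Omega> \<and> smooth_boundary \<Omega>"

section \<open>Potentials and capacity\<close>

definition potential :: "'a::euclidean_space set \<Rightarrow> ('a \<Rightarrow> ennreal) \<Rightarrow> bool" where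
  "potential \<Omega> V \<longleftrightarrow>
     V \<in> borel_measurable (lebesgue_on \<Omega>) \<and> \<not> (AE x in lebesgue_on \<Omega>. V x = 0)"

text \<open>The class \<open>C\<^sup>2\<^sub>c(\<Omega>)\<close>, with functions extended by zero to the whole space.\<close>

definition C2c :: "'a::euclidean_space set \<Rightarrow> ('a \<Rightarrow> real) set" where
  "C2c \<Omega> = {\<psi>. Ck_on 2 \<psi> \<Omega> \<and> compact (closure {x. \<psi> x \<noteq> 0}) \<and> closure {x. \<psi> x \<noteq> 0} \<subseteq> \<Omega>}"

definition ennreal_sqrt :: "ennreal \<Rightarrow> ennreal" where
  "ennreal_sqrt v = (if v = top then top else ennreal (sqrt (enn2real v)))"

text \<open>Division on \<^typ>\<open>ennreal\<close> gives the intended conventions for a finite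
  numerator \<open>t\<close>: \<open>0 / v = 0\<close> for every \<open>v\<close> (including \<open>v = 0\<close>),
  \<open>t / top = 0\<close>, and \<open>t / 0 = top\<close> if \<open>t \<noteq> 0\<close>. Both quotients are
  taken in absolute value.\<close>

definition V_norm :: "'a::euclidean_space set \<Rightarrow> ('a \<Rightarrow> ennreal) \<Rightarrow> ('a \<Rightarrow> real) \<Rightarrow> ennreal" where
  "V_norm \<Omega> V \<psi> =
     (\<integral>\<^sup>+x. ennreal \<bar>\<psi> x\<bar> \<partial>lebesgue_on \<Omega>)
     + esssup (lebesgue_on \<Omega>) (\<lambda>x. ennreal (norm (gradient \<psi> x)) / ennreal_sqrt (V x))
     + esssup (lebesgue_on \<Omega>) (\<lambda>x. ennreal \<bar>laplacian \<psi> x\<bar> / V x)"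

definition B2 :: "'a::euclidean_space set \<Rightarrow> 'a set \<Rightarrow> ('a \<Rightarrow> real) set" where
  "B2 \<Omega> K = {\<psi> \<in> C2c \<Omega>. (\<forall>x\<in>\<Omega>. 0 \<le> \<psi> x \<and> \<psi> x \<le> 1) \<and>
                (\<exists>U. open U \<and> K \<subseteq> U \<and> U \<subseteq> \<Omega> \<and> (\<forall>x\<in>U. \<psi> x = 1))}"

definition Cap :: "'a::euclidean_space set \<Rightarrow> ('a \<Rightarrow> ennreal) \<Rightarrow> 'a set \<Rightarrow> ennreal" where
  "Cap \<Omega> V K = (INF \<psi>\<in>B2 \<Omega> K. V_norm \<Omega> V \<psi>)"

end

theory Submission
  imports Defs
begin

text \<open>The gradient term of the norm alone forces positivity. The hypothesis on \<open>V\<close> gives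
  \<open>sqrt (V x) \<le> sqrt c * norm (x - a) powr (- m/2)\<close> near \<open>a\<close>, and because
  \<open>m/2 < 1\<close> this bound is integrable along each ray issuing from \<open>a\<close>. If \<open>\<psi>\<close>
  is a competitor of norm less than \<open>d\<close>, then \<open>norm (gradient \<psi> x)\<close> is at most
  \<open>d\<close> times this bound, first almost everywhere and then, by continuity, everywhere off
  \<open>a\<close> (\<open>continuous_le_from_AE\<close>). Integrating from \<open>a\<close>, where
  \<open>\<psi> = 1\<close>, yields
  \<open>\<psi> x \<ge> 1 - d * sqrt c / (1 - m/2) * norm (x - a) powr (1 - m/2)\<close>
  (\<open>radial_gradient_estimate\<close>). So if
  \<open>d\<close> is small, then \<open>\<psi> \<ge> 1/2\<close> on a fixed ball around \<open>a\<close>, and the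
  \<open>L\<^sup>1\<close> norm of \<open>\<psi>\<close> is at least half the volume of this ball, which bounds
  \<open>d\<close> below. How small \<open>d\<close> must be depends only on \<open>c\<close>, \<open>m\<close> and the
  radius, so the bound is uniform in \<open>\<psi>\<close>.\<close>

lemma has_derivative_gradient:
  assumes "f differentiable (at x)"
  shows "(f has_derivative (\<lambda>h. gradient f x \<bullet> h)) (at x)"
proof -
  have D: "(f has_derivative frechet_derivative f (at x)) (at x)"
    using assms by (simp add: frechet_derivative_works)
  then have lin: "linear (frechet_derivative f (at x))"
    by (rule has_derivative_linear)
  have "frechet_derivative f (at x) h = gradient f x \<bullet> h" for h
  proof -
    have "frechet_derivative f (at x) h
        = frechet_derivative f (at x) (\<Sum>i\<in>Basis. (h \<bullet> i) *\<^sub>R i)"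
      by (simp add: euclidean_representation)
    also have "\<dots> = (\<Sum>i\<in>Basis. (h \<bullet> i) * partial i f x)"
      by (simp add: linear_sum[OF lin] linear_scale[OF lin] partial_def)
    also have "\<dots> = gradient f x \<bullet> h"
      by (simp add: gradient_def inner_sum_right inner_commute[of _ h] mult.commute)
    finally show ?thesis .
  qed
  then have "frechet_derivative f (at x) = (\<lambda>h. gradient f x \<bullet> h)" ..
  with D show ?thesis by simp
qed

lemma continuous_on_gradient:
  assumes "Ck_on 2 f S"
  shows "continuous_on S (gradient f)"
proof -
  have "continuous_on S (partial i f)" if "i \<in> Basis" for i
    using assms that
    by (auto simp: numeral_2_eq_2 intro!: continuous_at_imp_continuous_on
        differentiable_imp_continuous_within)
  then have "continuous_on S (\<lambda>x. \<Sum>i\<in>Basis. partial i f x *\<^sub>R i)"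
    by (intro continuous_intros)
  then show ?thesis
    by (simp add: gradient_def[abs_def])
qed

text \<open>The set where the inequality fails is open, and a nonempty open set is not negligible.\<close>

lemma continuous_le_from_AE:
  fixes f g :: "'a::euclidean_space \<Rightarrow> real"
  assumes "open S" "continuous_on S f" "continuous_on S g"
    and "AE x in lebesgue. x \<in> S \<longrightarrow> f x \<le> g x"
    and "x \<in> S"
  shows "f x \<le> g x"
proof -
  let ?N = "{x\<in>S. g x < f x}"
  have "continuous_on S (\<lambda>x. f x - g x)"
    using assms by (intro continuous_intros)
  then have "open (S \<inter> (\<lambda>x. f x - g x) -` {0<..})"
    using \<open>open S\<close> by (rule continuous_open_preimage) simp
  moreover have "S \<inter> (\<lambda>x. f x - g x) -` {0<..} = ?N"
    by auto
  ultimately have "open ?N" by simp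
  moreover have "negligible ?N"
  proof -
    from \<open>open ?N\<close> have "?N \<in> sets lebesgue" by (simp add: borel_open)
    with assms(4) have "?N \<in> null_sets lebesgue"
      by (subst AE_iff_null_sets) (auto elim: eventually_mono)
    then show ?thesis by (simp add: negligible_iff_null_sets)
  qed
  ultimately have "?N = {}"
    using open_not_negligible by blast
  with \<open>x \<in> S\<close> show ?thesis by (auto simp: not_less[symmetric])
qed

text \<open>Turns a bound on the quotient into a bound on its numerator; for \<open>v = 0\<close> finiteness of
  the quotient forces the numerator to vanish.\<close>

lemma le_if_div_ennreal_sqrt_le:
  assumes "ennreal t / ennreal_sqrt v \<le> ennreal d" "v \<le> ennreal w"
    and "0 \<le> t" "0 \<le> d" "0 \<le> w"
  shows "t \<le> d * sqrt w"
proof -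
  have "v \<noteq> top"
    using assms(2) by (metis ennreal_neq_top top.extremum_uniqueI)
  then obtain u where u: "v = ennreal u" "0 \<le> u"
    by (cases v) auto
  then have "u \<le> w"
    using assms by (simp add: ennreal_le_iff)
  have sq: "ennreal_sqrt v = ennreal (sqrt u)"
    using u by (simp add: ennreal_sqrt_def)
  show ?thesis
  proof (cases "u = 0")
    case True
    then have "t = 0"
      using assms(1) sq \<open>0 \<le> t\<close>
      by (metis ennreal_0 ennreal_divide_eq_top_iff ennreal_eq_0_iff ennreal_neq_top
          order_antisym real_sqrt_zero top.extremum_uniqueI)
    then show ?thesis using assms by simp
  next
    case False
    then have "t / sqrt u \<le> d"
      using assms(1) sq u \<open>0 \<le> t\<close> \<open>0 \<le> d\<close> by (simp add: divide_ennreal)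
    then have "t \<le> d * sqrt u"
      using False u by (simp add: field_simps)
    also have "\<dots> \<le> d * sqrt w"
      using \<open>u \<le> w\<close> \<open>0 \<le> d\<close> by (simp add: mult_left_mono)
    finally show ?thesis .
  qed
qed

text \<open>Along the ray from \<open>a\<close> through \<open>x\<close>, adding the primitive
  \<open>L / (1 - p) * t powr (1 - p)\<close> of the bound to \<open>f\<close> gives a nondecreasing function of
  the distance \<open>t\<close>. The condition \<open>p < 1\<close> makes this primitive continuous at
  \<open>0\<close>, so that monotonicity extends to the endpoint although the bound may blow up
  there.\<close>

lemma radial_gradient_estimate:
  fixes f :: "'a::euclidean_space \<Rightarrow> real"
  assumes "p < 1"
    and cont: "continuous_on (ball a R) f"
    and diff: "\<And>x. x \<in> ball a R - {a} \<Longrightarrow> f differentiable (at x)"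
    and bound: "\<And>x. x \<in> ball a R - {a} \<Longrightarrow> norm (gradient f x) \<le> L * norm (x - a) powr (- p)"
    and "x \<in> ball a R"
  shows "f a - L / (1 - p) * norm (x - a) powr (1 - p) \<le> f x"
proof (cases "x = a")
  case True
  then show ?thesis by simp
next
  case False
  define r where "r = norm (x - a)"
  define v where "v = (x - a) /\<^sub>R r"
  have r: "0 < r" "r < R"
    using False \<open>x \<in> ball a R\<close> by (auto simp: r_def dist_norm norm_minus_commute)
  have v: "norm v = 1" "a + r *\<^sub>R v = x"
    using r(1) by (auto simp: v_def) (simp add: r_def)
  define h where "h t = f (a + t *\<^sub>R v) + L / (1 - p) * t powr (1 - p)" for t
  have inball: "a + t *\<^sub>R v \<in> ball a R" if "0 \<le> t" "t \<le> r" for t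
    using that r v by (simp add: dist_norm)
  have "h 0 \<le> h r"
  proof (rule DERIV_nonneg_imp_increasing_open[of 0 r h])
    show "0 \<le> r" using r by simp
  next
    fix t assume t: "0 < t" "t < r"
    let ?x = "a + t *\<^sub>R v"
    have x: "?x \<in> ball a R - {a}"
      using inball[of t] t v by auto
    have nx: "norm (?x - a) = t"
      using t v by simp
    have "((\<lambda>t. f (a + t *\<^sub>R v)) has_derivative (\<lambda>s. gradient f ?x \<bullet> (s *\<^sub>R v))) (at t)"
      by (rule has_derivative_compose[where f = "\<lambda>t. a + t *\<^sub>R v",
            OF _ has_derivative_gradient[OF diff[OF x]]])
        (auto intro!: derivative_eq_intros)
    then have 1: "((\<lambda>t. f (a + t *\<^sub>R v)) has_real_derivative gradient f ?x \<bullet> v) (at t)"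
      by (simp add: has_field_derivative_def mult_commute_abs)
    have 2: "((\<lambda>t. L / (1 - p) * t powr (1 - p)) has_real_derivative L * t powr (- p)) (at t)"
      using t \<open>p < 1\<close> by (auto intro!: derivative_eq_intros)
    have "\<bar>gradient f ?x \<bullet> v\<bar> \<le> norm (gradient f ?x)"
      using Cauchy_Schwarz_ineq2[of "gradient f ?x" v] v by simp
    also have "\<dots> \<le> L * t powr (- p)"
      using bound[OF x] nx by simp
    finally have "0 \<le> gradient f ?x \<bullet> v + L * t powr (- p)" by linarith
    with DERIV_add[OF 1 2] show "\<exists>y. (h has_real_derivative y) (at t) \<and> 0 \<le> y"
      unfolding h_def[abs_def] by blast
  next
    have "continuous_on {0..r} (\<lambda>t. f (a + t *\<^sub>R v))"
      by (rule continuous_on_compose2[OF cont]) (use inball in \<open>auto intro!: continuous_intros\<close>)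
    moreover have "continuous_on {0..r} (\<lambda>t. t powr (1 - p))"
      using \<open>p < 1\<close> by (intro continuous_on_powr') (auto intro!: continuous_intros)
    ultimately show "continuous_on {0..r} h"
      unfolding h_def[abs_def] by (intro continuous_on_add continuous_on_mult_left)
  qed
  then show ?thesis
    using v \<open>p < 1\<close> by (simp add: h_def r_def)
qed

text \<open>The two smallness conditions on \<open>d\<close> match the two terms of the norm that are used:
  the first says that the gradient term allows \<open>\<psi>\<close> to drop by at most \<open>1/2\<close>
  between the center and the sphere of radius \<open>R\<close>, and the second compares \<open>d\<close> with
  the \<open>L\<^sup>1\<close> norm that this leaves on the ball.\<close>

lemma V_norm_lower_bound:
  fixes \<Omega> :: "'a::euclidean_space set"
  assumes "open \<Omega>" "0 < R" and sub: "ball a R \<subseteq> \<Omega>" and "0 < c" "m < 2"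
    and V: "\<And>x. x \<in> ball a R - {a} \<Longrightarrow> V x \<le> ennreal (c / norm (x - a) powr m)"
    and \<psi>: "\<psi> \<in> B2 \<Omega> {a}"
    and d: "0 < d" "d * sqrt c / (1 - m / 2) * R powr (1 - m / 2) \<le> 1 / 2"
      "d \<le> measure lebesgue (ball a R) / 2"
  shows "ennreal d \<le> V_norm \<Omega> V \<psi>"
proof (rule ccontr)
  assume "\<not> ?thesis"
  then have less: "V_norm \<Omega> V \<psi> < ennreal d" by simp
  let ?L = "d * sqrt c"
  let ?q = "\<lambda>x. ennreal (norm (gradient \<psi> x)) / ennreal_sqrt (V x)"
  have ck: "Ck_on 2 \<psi> \<Omega>" and "\<psi> a = 1"
    using \<psi> by (auto simp: B2_def C2c_def)
  then have diff: "\<psi> differentiable (at x)" if "x \<in> \<Omega>" for x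
    using that by (simp add: numeral_2_eq_2)
  have \<Omega>: "\<Omega> \<in> sets lebesgue"
    using \<open>open \<Omega>\<close> by (simp add: borel_open)
  have "esssup (lebesgue_on \<Omega>) ?q \<le> V_norm \<Omega> V \<psi>"
    unfolding V_norm_def by (intro add_increasing2 add_increasing zero_le order_refl)
  then have q: "esssup (lebesgue_on \<Omega>) ?q \<le> ennreal d"
    using less by simp
  have "AE x in lebesgue_on \<Omega>. ?q x \<le> ennreal d"
    using esssup_AE[of ?q "lebesgue_on \<Omega>"] by eventually_elim (use q in simp)
  then have "AE x in lebesgue. x \<in> \<Omega> \<longrightarrow> ?q x \<le> ennreal d"
    using \<Omega> by (subst (asm) AE_restrict_space_iff) auto
  then have "AE x in lebesgue. x \<in> ball a R - {a} \<longrightarrow>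
      norm (gradient \<psi> x) \<le> ?L * norm (x - a) powr (- (m / 2))"
  proof (eventually_elim, intro impI)
    fix x assume q: "x \<in> \<Omega> \<longrightarrow> ?q x \<le> ennreal d" and x: "x \<in> ball a R - {a}"
    have "norm (gradient \<psi> x) \<le> d * sqrt (c / norm (x - a) powr m)"
      using q sub x V[OF x] d(1) \<open>0 < c\<close> by (intro le_if_div_ennreal_sqrt_le[of _ "V x"]) auto
    also have "sqrt (c / norm (x - a) powr m) = sqrt c * norm (x - a) powr (- (m / 2))"
      by (simp add: real_sqrt_divide powr_minus_divide powr_half_sqrt_powr)
    finally show "norm (gradient \<psi> x) \<le> ?L * norm (x - a) powr (- (m / 2))"
      by simp
  qed
  moreover have "continuous_on (ball a R - {a}) (\<lambda>x. norm (gradient \<psi> x))"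
    using continuous_on_gradient[OF ck] sub
    by (intro continuous_on_norm) (auto elim: continuous_on_subset)
  moreover have "continuous_on (ball a R - {a}) (\<lambda>x. ?L * norm (x - a) powr (- (m / 2)))"
    by (intro continuous_intros) auto
  ultimately have grad: "norm (gradient \<psi> x) \<le> ?L * norm (x - a) powr (- (m / 2))"
    if "x \<in> ball a R - {a}" for x
    using that by (intro continuous_le_from_AE[where S = "ball a R - {a}" and x = x]) auto
  have half: "1 / 2 \<le> \<psi> x" if x: "x \<in> ball a R" for x
  proof -
    have "continuous_on (ball a R) \<psi>"
      using diff sub by (auto intro!: continuous_at_imp_continuous_on
          differentiable_imp_continuous_within)
    then have "\<psi> a - ?L / (1 - m / 2) * norm (x - a) powr (1 - m / 2) \<le> \<psi> x"
      using \<open>m < 2\<close> diff sub grad x by (intro radial_gradient_estimate[where R = R]) auto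
    moreover have "?L / (1 - m / 2) * norm (x - a) powr (1 - m / 2)
        \<le> ?L / (1 - m / 2) * R powr (1 - m / 2)"
      using x \<open>m < 2\<close> \<open>0 < c\<close> d(1)
      by (intro mult_left_mono powr_mono2) (auto simp: dist_norm norm_minus_commute)
    ultimately show ?thesis
      using d(2) \<open>\<psi> a = 1\<close> by linarith
  qed
  have "ennreal d \<le> ennreal (1 / 2 * measure lebesgue (ball a R))"
    using d(3) by (intro ennreal_leI) simp
  also have "\<dots> = ennreal (1 / 2) * emeasure lebesgue (ball a R)"
    by (simp only: ennreal_mult' emeasure_eq_measure2[OF lmeasurable_ball] measure_nonneg)
  also have "\<dots> = ennreal (1 / 2) * emeasure (lebesgue_on \<Omega>) (ball a R)"
    using \<Omega> sub by (subst emeasure_restrict_space) auto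
  also have "\<dots> = (\<integral>\<^sup>+x. ennreal (1 / 2) * indicator (ball a R) x \<partial>lebesgue_on \<Omega>)"
    using \<Omega> sub by (subst nn_integral_cmult_indicator) (auto simp: sets_restrict_space_iff)
  also have "\<dots> \<le> (\<integral>\<^sup>+x. ennreal \<bar>\<psi> x\<bar> \<partial>lebesgue_on \<Omega>)"
  proof (rule nn_integral_mono)
    fix x
    show "ennreal (1 / 2) * indicator (ball a R) x \<le> ennreal \<bar>\<psi> x\<bar>"
    proof (cases "x \<in> ball a R")
      case True
      then have "1 / 2 \<le> \<bar>\<psi> x\<bar>" using half[of x] by linarith
      then show ?thesis using True by (simp add: ennreal_leI del: ennreal_half)
    qed simp
  qed
  also have "\<dots> \<le> V_norm \<Omega> V \<psi>"
    unfolding V_norm_def by (intro add_increasing2 zero_le order_refl)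
  finally show False using less by simp
qed

theorem theorem4:
  fixes \<Omega> :: "(real ^ 'n) set" and V :: "real ^ 'n \<Rightarrow> ennreal"
    and a :: "real ^ 'n" and \<eta> c m :: real
  assumes "smooth_bounded_domain \<Omega>"
    and "potential \<Omega> V"
    and "a \<in> \<Omega>"
    and "\<eta> > 0" and "c > 0" and "m < 2"
    and "\<And>x. x \<in> \<Omega> \<inter> ball a (2 * \<eta>) \<Longrightarrow> x \<noteq> a \<Longrightarrow> V x \<le> ennreal (c / norm (x - a) powr m)"
  shows "Cap \<Omega> V {a} > 0"
proof -
  have "open \<Omega>"
    using assms(1) by (simp add: smooth_bounded_domain_def)
  then obtain \<rho> where \<rho>: "0 < \<rho>" "ball a \<rho> \<subseteq> \<Omega>"
    using \<open>a \<in> \<Omega>\<close> by (auto simp: open_contains_ball)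
  define R where "R = min \<rho> (2 * \<eta>)"
  have R: "0 < R" "ball a R \<subseteq> \<Omega>" "ball a R \<subseteq> ball a (2 * \<eta>)"
    using \<rho> \<open>\<eta> > 0\<close> by (auto simp: R_def)
  define k where "k = sqrt c / (1 - m / 2) * R powr (1 - m / 2)"
  have "0 < k"
    using R(1) \<open>c > 0\<close> \<open>m < 2\<close> by (simp add: k_def)
  define d where "d = min (1 / (2 * k)) (measure lebesgue (ball a R) / 2)"
  have d: "0 < d" "d * k \<le> 1 / 2" "d \<le> measure lebesgue (ball a R) / 2"
  proof -
    show "0 < d"
      using \<open>0 < k\<close> content_ball_pos[OF R(1), of a] by (simp add: d_def)
    have "d * k \<le> 1 / (2 * k) * k"
      using \<open>0 < k\<close> by (intro mult_right_mono) (auto simp: d_def)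
    then show "d * k \<le> 1 / 2" using \<open>0 < k\<close> by simp
    show "d \<le> measure lebesgue (ball a R) / 2" by (simp add: d_def)
  qed
  have "ennreal d \<le> V_norm \<Omega> V \<psi>" if "\<psi> \<in> B2 \<Omega> {a}" for \<psi>
  proof (rule V_norm_lower_bound[OF \<open>open \<Omega>\<close> R(1,2) \<open>c > 0\<close> \<open>m < 2\<close> _ that d(1) _ d(3)])
    show "V x \<le> ennreal (c / norm (x - a) powr m)" if "x \<in> ball a R - {a}" for x
      using that R by (intro assms(7)) auto
    show "d * sqrt c / (1 - m / 2) * R powr (1 - m / 2) \<le> 1 / 2"
      using d(2) by (simp add: k_def)
  qed
  then have "ennreal d \<le> Cap \<Omega> V {a}"
    unfolding Cap_def by (intro INF_greatest)
  moreover have "0 < ennreal d"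
    using d(1) by simp
  ultimately show ?thesis by order
qed

end
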